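(* Let $A\in\mathbb{K}_k^{n\times n}$ and suppose that, for every $j=1,\dots,k$, the block $\hat A_j\in\mathbb{C}^{n\times n}$ of $\mathrm{cft}(A)$ has distinct eigenvalues with distinct magnitudes. Then $A$ has a unique canonical set of $n$ eigenvalues and eigenvectors (eigenvectors being considered up to normalization). This canonical set corresponds to a basis of $\mathbb{K}_k^n$ consisting of $n$ eigenvectors, yielding an eigendecomposition $$A = X\circ\Lambda\circ X^{-1},$$ where $X\in\mathbb{K}_k^{n\times n}$ has the canonical eigenvectors as its columns and $\Lambda\in\mathbb{K}_k^{n\times n}$ is diagonal with $\Lambda_{i,i}=\lambda_i$, the $i$-th canonical eigenvalue.
   Context: Circulant algebra. $\mathbb{K}_k$ is the commutative ring of length-$k$ parameter tuples $\alpha=\{\alpha_1,\dots,\alpha_k\}$ (complex entries allowed), identified with the $k\times k$ circulant matrix $\mathrm{circ}(\alpha)$ whose first column is $(\alpha_1,\dots,\alpha_k)^T$; sum and product are those of the circulant matrices: $\mathrm{circ}(\alpha+\beta)=\mathrm{circ}(\alpha)+\mathrm{circ}(\beta)$, $\mathrm{circ}(\alpha\circ\beta)=\mathrm{circ}(\alpha)\,\mathrm{circ}(\beta)$. The identity is $\{1,0,\dots,0\}$. $\mathbb{K}_k^n$ and $\mathbb{K}_k^{m\times n}$ are vectors and matrices over this ring, with the usual matrix product, also written $\circ$. Fourier coefficients. Let $F$ be the $k\times k$ unitary matrix with $F_{ij}=\omega^{(i-1)(j-1)}/\sqrt{k}$, $\omega=e^{2\pi \mathrm{i}/k}$. Put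 $\mathrm{cft}(\alpha)=F^*\mathrm{circ}(\alpha)F=\mathrm{diag}(\hat\alpha_1,\dots,\hat\alpha_k)$. For $A\in\mathbb{K}_k^{m\times n}$, $\mathrm{cft}(A)$ is the block-diagonal matrix with blocks $\hat A_1,\dots,\hat A_k\in\mathbb{C}^{m\times n}$, where the $(r,s)$ entry of $\hat A_j$ is the $j$-th diagonal entry of $\mathrm{cft}(A_{r,s})$; similarly $x\in\mathbb{K}_k^n$ has blocks $\hat x_1,\dots,\hat x_k\in\mathbb{C}^n$. Absolute value and order. $\mathrm{abs}(\alpha)\in\mathbb{K}_k$ is the element with $\mathrm{cft}(\mathrm{abs}(\alpha))=\mathrm{diag}(|\hat\alpha_1|,\dots,|\hat\alpha_k|)$. For elements with real Fourier coefficients, $\alpha\le\beta$ means $\hat\alpha_j\le\hat\beta_j$ for all $j$. Eigenpairs. $\lambda\in\mathbb{K}_k$ is an eigenvalue of $A\in\mathbb{K}_k^{n\times n}$ if $\det(A-\lambda\circ I)=0$ in $\mathbb{K}_k$; a corresponding eigenvector is $x\in\mathbb{K}_k^n$ with $A\circ x=\lambda\circ x$ and $\hat x_j\neq0$ for all $j$. Equivalently, for every $j$, $(\hat\lambda_j,\hat x_j)$ is an eigenpair of $\hat A_j$. Eigenvectors are considered up to normalization, i.e. up to multiplication by an invertible element of $\mathbb{K}_k$. Canonical set. A canonical set of eigenvalues and eigenvectors of $A$ is a set of eigenpairs $(\lambda_1,x_1),\dots,(\lambda_s,x_s)$ of minimum size, ordered such that $\mathrm{abs}(\lambda_1)\ge\mathrm{abs}(\lambda_2)\ge\cdots\ge\mathrm{abs}(\lambda_s)$,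 which contains the information to reproduce any eigenvalue or eigenvector of $A$; that is, for each $j$, every eigenpair of $\hat A_j$ occurs (up to scaling of the eigenvector) as the $j$-th Fourier component $((\hat\lambda_i)_j,(\hat x_i)_j)$ of some $(\lambda_i,x_i)$ in the set. A basis of $\mathbb{K}_k^n$ is meant in the sense of free modules over the ring $\mathbb{K}_k$. *)

theory Defs
  imports
    "Jordan_Normal_Form.Spectral_Radius"
    "Jordan_Normal_Form.VS_Connect"
    "Jordan_Normal_Form.Determinant"
    "HOL-Library.Cardinality"
begin

text \<open>
  Elements are tuples of length \<open>k\<close>; addition is entrywise and the product is the first
  column of the product of the associated circulant matrices (see \<open>circ_mult\<close> below).
  The finite index type \<open>'k\<close> only carries the number \<open>k = CARD('k)\<close>, so \<open>k\<close> is an arbitrary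
  positive integer. All indices are 0-based.
\<close>

typedef ('k::finite) circulant = "carrier_vec CARD('k) :: complex Matrix.vec set"
  morphisms params Circulant
  by (rule exI[of _ "0\<^sub>v CARD('k)"]) simp

definition circ :: "'k::finite circulant \<Rightarrow> complex mat" where
  "circ a = mat CARD('k) CARD('k)
     (\<lambda>(i, j). params a $ nat ((int i - int j) mod int CARD('k)))"

instantiation circulant :: (finite) "{zero, one, plus, minus, uminus, times}"
begin

definition zero_circulant_def: "0 = (Circulant (0\<^sub>v CARD('a)) :: 'a circulant)"
definition one_circulant_def: "1 = (Circulant (unit_vec CARD('a) 0) :: 'a circulant)"
definition plus_circulant_def: "a + b = Circulant (params a + params (b :: 'a circulant))"
definition minus_circulant_def: "a - b = Circulant (params a - params (b :: 'a circulant))"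
definition uminus_circulant_def: "- a = Circulant (- params (a :: 'a circulant))"
definition times_circulant_def:
  "a * b = Circulant (col (circ a * circ (b :: 'a circulant)) 0)"

instance ..

end

text \<open>The \<open>k\<close>-periodic extension of the parameter tuple, used only for calculations.\<close>

definition periodic_param :: "'k::finite circulant \<Rightarrow> int \<Rightarrow> complex" where
  "periodic_param a z = params a $ nat (z mod int CARD('k))"

lemma CARD_pos [simp]: "0 < CARD('k::finite)"
  by (simp add: card_gt_0_iff)

lemma nat_mod_CARD_less: "nat (z mod int CARD('k::finite)) < CARD('k)"
  by (metis CARD_pos nat_less_iff of_nat_0_less_iff pos_mod_bound pos_mod_sign)

lemma params_carrier [simp]: "params (a :: 'k::finite circulant) \<in> carrier_vec CARD('k)"
  by (rule params)

lemma dim_params [simp]: "dim_vec (params (a :: 'k::finite circulant)) = CARD('k)"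
  using params_carrier[of a] by (simp only: carrier_vec_def mem_Collect_eq)

lemma periodic_param_mod [simp]:
  "periodic_param (a :: 'k::finite circulant) (z mod int CARD('k)) = periodic_param a z"
  by (simp add: periodic_param_def)

lemma periodic_param_cong:
  "x mod int CARD('k) = y mod int CARD('k) \<Longrightarrow>
     periodic_param (a :: 'k::finite circulant) x = periodic_param a y"
  by (simp add: periodic_param_def)

lemma params_nth: "i < CARD('k) \<Longrightarrow> params (a :: 'k::finite circulant) $ i = periodic_param a (int i)"
  by (simp add: periodic_param_def)

lemma circulant_eqI:
  assumes "\<And>z. periodic_param a z = periodic_param b z"
  shows "(a :: 'k::finite circulant) = b"
proof -
  have "params a = params b"
    by (rule eq_vecI) (simp_all add: params_nth assms)
  then show ?thesis by (simp add: params_inject)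
qed

lemma circ_dim [simp]: "circ (a :: 'k::finite circulant) \<in> carrier_mat CARD('k) CARD('k)"
  by (simp add: circ_def)

lemma circ_nth:
  "i < CARD('k) \<Longrightarrow> j < CARD('k) \<Longrightarrow>
     circ (a :: 'k::finite circulant) $$ (i, j) = periodic_param a (int i - int j)"
  by (simp add: circ_def periodic_param_def)

lemma periodic_param_Circulant:
  "v \<in> carrier_vec CARD('k) \<Longrightarrow>
     periodic_param (Circulant v :: 'k::finite circulant) z = v $ nat (z mod int CARD('k))"
  by (simp add: periodic_param_def Circulant_inverse)

lemma periodic_param_zero [simp]: "periodic_param (0 :: 'k::finite circulant) z = 0"
  unfolding zero_circulant_def by (simp add: periodic_param_Circulant nat_mod_CARD_less)

lemma periodic_param_one:
  "periodic_param (1 :: 'k::finite circulant) z = (if z mod int CARD('k) = 0 then 1 else 0)"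
proof -
  have "z mod int CARD('k) \<ge> 0" by simp
  then have "nat (z mod int CARD('k)) = 0 \<longleftrightarrow> z mod int CARD('k) = 0" by linarith
  then show ?thesis
    unfolding one_circulant_def by (simp add: periodic_param_Circulant nat_mod_CARD_less)
qed

lemma periodic_param_add [simp]:
  "periodic_param (a + b :: 'k::finite circulant) z = periodic_param a z + periodic_param b z"
  unfolding plus_circulant_def
  by (simp add: periodic_param_Circulant nat_mod_CARD_less) (simp add: periodic_param_def)

lemma periodic_param_minus [simp]:
  "periodic_param (a - b :: 'k::finite circulant) z = periodic_param a z - periodic_param b z"
  unfolding minus_circulant_def
  by (simp add: periodic_param_Circulant nat_mod_CARD_less) (simp add: periodic_param_def)

lemma periodic_param_uminus [simp]:
  "periodic_param (- a :: 'k::finite circulant) z = - periodic_param a z"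
  unfolding uminus_circulant_def
  by (simp add: periodic_param_Circulant nat_mod_CARD_less) (simp add: periodic_param_def)

lemma periodic_param_times:
  "periodic_param (a * b :: 'k::finite circulant) z =
     (\<Sum>l<CARD('k). periodic_param a (z - int l) * periodic_param b (int l))"
proof -
  let ?i = "nat (z mod int CARD('k))"
  have i: "?i < CARD('k)" by (rule nat_mod_CARD_less)
  have [simp]: "dim_row (circ a) = CARD('k)" "dim_col (circ a) = CARD('k)"
    "dim_row (circ b) = CARD('k)" "dim_col (circ b) = CARD('k)"
    by (simp_all add: circ_def)
  have "col (circ a * circ b) 0 \<in> carrier_vec CARD('k)"
    by (rule carrier_vecI) simp
  then have "periodic_param (a * b) z = col (circ a * circ b) 0 $ ?i"
    unfolding times_circulant_def by (rule periodic_param_Circulant)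
  also have "\<dots> = (circ a * circ b) $$ (?i, 0)"
    by (rule index_col) (simp_all only: index_mult_mat(2,3) carrier_matD[OF circ_dim] i CARD_pos)
  also have "\<dots> = (\<Sum>l<CARD('k). circ a $$ (?i, l) * circ b $$ (l, 0))"
    using i by (simp add: scalar_prod_def atLeast0LessThan)
  also have "\<dots> = (\<Sum>l<CARD('k). periodic_param a (z - int l) * periodic_param b (int l))"
  proof (rule sum.cong)
    fix l assume l: "l \<in> {..<CARD('k)}"
    have "periodic_param a (int ?i - int l) = periodic_param a (z - int l)"
      by (rule periodic_param_cong) (simp add: mod_diff_left_eq)
    then show "circ a $$ (?i, l) * circ b $$ (l, 0) =
        periodic_param a (z - int l) * periodic_param b (int l)"
      using l i by (simp add: circ_nth)
  qed simp
  finally show ?thesis .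
qed

lemma sum_periodic:
  fixes f :: "int \<Rightarrow> complex"
  assumes k: "0 < k" and per: "\<And>z. f (z mod int k) = f z" and s: "s = 1 \<or> s = -1"
  shows "(\<Sum>l<k. f (c + s * int l)) = (\<Sum>l<k. f (int l))"
proof -
  define h where "h l = nat ((c + s * int l) mod int k)" for l
  have h: "int (h l) = (c + s * int l) mod int k" for l
    using k by (simp add: h_def)
  have ss: "s * s = 1" using s by auto
  have inj: "inj_on h {..<k}"
  proof (rule inj_onI)
    fix x y assume x: "x \<in> {..<k}" and y: "y \<in> {..<k}" and "h x = h y"
    then have "(c + s * int x) mod int k = (c + s * int y) mod int k" using h by metis
    then have "int k dvd (c + s * int x) - (c + s * int y)" by (simp only: mod_eq_dvd_iff)
    then have "int k dvd s * ((c + s * int x) - (c + s * int y))" by (rule dvd_mult)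
    also have "s * ((c + s * int x) - (c + s * int y)) = int x - int y"
      by (simp add: algebra_simps mult.assoc[symmetric] ss)
    finally have "int x mod int k = int y mod int k" by (simp only: mod_eq_dvd_iff)
    then show "x = y" using x y by simp
  qed
  have sub: "h ` {..<k} \<subseteq> {..<k}"
  proof
    fix y assume "y \<in> h ` {..<k}"
    then obtain l where y: "y = h l" by auto
    have "int (h l) < int k" unfolding h using k by simp
    then show "y \<in> {..<k}" by (simp add: y)
  qed
  have img: "h ` {..<k} = {..<k}" by (rule endo_inj_surj[OF _ sub inj]) simp
  have "(\<Sum>l<k. f (int l)) = (\<Sum>l\<in>h ` {..<k}. f (int l))" by (simp only: img)
  also have "\<dots> = (\<Sum>l<k. f (int (h l)))" by (simp add: sum.reindex[OF inj])
  also have "\<dots> = (\<Sum>l<k. f (c + s * int l))" by (simp only: h per)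
  finally show ?thesis by simp
qed

instance circulant :: (finite) comm_ring_1
proof
  fix a b c :: "'a circulant"
  let ?k = "CARD('a)"
  show "a * b * c = a * (b * c)"
  proof (rule circulant_eqI)
    fix z
    have "periodic_param (a * (b * c)) z =
        (\<Sum>l<?k. \<Sum>m<?k. periodic_param a (z - int l) *
           (periodic_param b (int l - int m) * periodic_param c (int m)))"
      by (simp add: periodic_param_times sum_distrib_left)
    also have "\<dots> = (\<Sum>m<?k. \<Sum>l<?k. periodic_param a (z - int l) *
           (periodic_param b (int l - int m) * periodic_param c (int m)))"
      by (rule sum.swap)
    also have "\<dots> = (\<Sum>m<?k. \<Sum>l<?k. periodic_param a (z - int m - int l) *
           periodic_param b (int l) * periodic_param c (int m))"
    proof (rule sum.cong)
      fix m
      define f where "f y = periodic_param a (z - y) *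
           (periodic_param b (y - int m) * periodic_param c (int m))" for y
      have "f (y mod int ?k) = f y" for y
      proof -
        have "periodic_param a (z - y mod int ?k) = periodic_param a (z - y)"
          "periodic_param b (y mod int ?k - int m) = periodic_param b (y - int m)"
          by (rule periodic_param_cong, simp add: mod_diff_right_eq mod_diff_left_eq)+
        then show ?thesis by (simp add: f_def)
      qed
      then have "(\<Sum>l<?k. f (int m + 1 * int l)) = (\<Sum>l<?k. f (int l))"
        by (intro sum_periodic) auto
      then show "(\<Sum>l<?k. periodic_param a (z - int l) *
           (periodic_param b (int l - int m) * periodic_param c (int m))) =
         (\<Sum>l<?k. periodic_param a (z - int m - int l) *
           periodic_param b (int l) * periodic_param c (int m))"
        by (simp add: f_def algebra_simps)
    qed simp
    also have "\<dots> = periodic_param (a * b * c) z"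
      by (simp add: periodic_param_times sum_distrib_right)
    finally show "periodic_param (a * b * c) z = periodic_param (a * (b * c)) z" by simp
  qed
  show "a * b = b * a"
  proof (rule circulant_eqI)
    fix z
    define f where "f y = periodic_param a (z - y) * periodic_param b y" for y
    have "f (y mod int ?k) = f y" for y
    proof -
      have "periodic_param a (z - y mod int ?k) = periodic_param a (z - y)"
        by (rule periodic_param_cong, simp add: mod_diff_right_eq)
      then show ?thesis by (simp add: f_def)
    qed
    then have "(\<Sum>l<?k. f (z + (-1) * int l)) = (\<Sum>l<?k. f (int l))"
      by (intro sum_periodic) auto
    then show "periodic_param (a * b) z = periodic_param (b * a) z"
      by (simp add: periodic_param_times f_def mult.commute)
  qed
  show "1 * a = a"
  proof (rule circulant_eqI)
    fix z
    let ?i = "nat (z mod int ?k)"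
    have i: "int ?i = z mod int ?k" by simp
    have "periodic_param (1 * a) z =
        (\<Sum>l<?k. if l = ?i then periodic_param a (int l) else 0)"
      unfolding periodic_param_times
    proof (rule sum.cong)
      fix l assume "l \<in> {..<?k}"
      then have l: "int l mod int ?k = int l" by simp
      have "(z - int l) mod int ?k = 0 \<longleftrightarrow> z mod int ?k = int l mod int ?k"
        by (simp only: mod_eq_dvd_iff dvd_eq_mod_eq_0)
      also have "\<dots> \<longleftrightarrow> int ?i = int l" by (simp only: l i)
      finally have "(z - int l) mod int ?k = 0 \<longleftrightarrow> l = ?i" by auto
      then show "periodic_param (1 :: 'a circulant) (z - int l) * periodic_param a (int l) =
          (if l = ?i then periodic_param a (int l) else 0)"
        by (simp add: periodic_param_one)
    qed simp
    also have "\<dots> = periodic_param a z"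
      using nat_mod_CARD_less[where 'k = 'a, of z] by (simp add: i)
    finally show "periodic_param (1 * a) z = periodic_param a z" .
  qed
  show "(a + b) * c = a * c + b * c"
    by (rule circulant_eqI) (simp add: periodic_param_times distrib_right sum.distrib)
  have "periodic_param (0 :: 'a circulant) 0 \<noteq> periodic_param (1 :: 'a circulant) 0"
    by (simp add: periodic_param_one)
  then show "(0 :: 'a circulant) \<noteq> 1" by metis
qed (rule circulant_eqI; simp)+

lemma circ_add: "circ (a + b) = circ a + circ (b :: 'k::finite circulant)"
  by (rule eq_matI) (auto simp: circ_nth carrier_matD[OF circ_dim])

lemma circ_mult: "circ (a * b) = circ a * circ (b :: 'k::finite circulant)"
proof (rule eq_matI)
  fix i j assume "i < dim_row (circ a * circ b)" "j < dim_col (circ a * circ b)"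
  then have i: "i < CARD('k)" and j: "j < CARD('k)"
    by (auto simp: carrier_matD[OF circ_dim])
  define f where "f y = periodic_param a (int i - y) * periodic_param b (y - int j)" for y
  have "f (y mod int CARD('k)) = f y" for y
  proof -
    have "periodic_param a (int i - y mod int CARD('k)) = periodic_param a (int i - y)"
      "periodic_param b (y mod int CARD('k) - int j) = periodic_param b (y - int j)"
      by (rule periodic_param_cong, simp add: mod_diff_right_eq mod_diff_left_eq)+
    then show ?thesis by (simp add: f_def)
  qed
  then have "(\<Sum>l<CARD('k). f (int j + 1 * int l)) = (\<Sum>l<CARD('k). f (int l))"
    by (intro sum_periodic) auto
  moreover have "(circ a * circ b) $$ (i, j) = (\<Sum>l<CARD('k). f (int l))"
    using i j
    by (simp add: scalar_prod_def atLeast0LessThan carrier_matD[OF circ_dim] circ_nth f_def)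
  moreover have "circ (a * b) $$ (i, j) = (\<Sum>l<CARD('k). f (int j + 1 * int l))"
    using i j by (simp add: circ_nth periodic_param_times f_def diff_diff_eq)
  ultimately show "circ (a * b) $$ (i, j) = (circ a * circ b) $$ (i, j)" by simp
qed (auto simp: carrier_matD[OF circ_dim])

definition fourier_mat :: "nat \<Rightarrow> complex mat" where
  "fourier_mat k =
     mat k k (\<lambda>(i, j). cis (2 * pi / real k) ^ (i * j) / complex_of_real (sqrt (real k)))"

definition cft :: "'k::finite circulant \<Rightarrow> complex mat" where
  "cft a = mat_adjoint (fourier_mat CARD('k)) * circ a * fourier_mat CARD('k)"

definition fcoeff :: "nat \<Rightarrow> 'k::finite circulant \<Rightarrow> complex" where
  "fcoeff j a = cft a $$ (j, j)"

text \<open>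
  The next lemmas confirm that \<open>cft\<close> produces diagonal matrices, that every diagonal matrix
  is \<open>cft\<close> of a unique circulant, and hence that the description in \<open>circ_abs\<close> is proper.
\<close>

definition unit_root :: "nat \<Rightarrow> int \<Rightarrow> complex" where
  "unit_root k z = cis (2 * pi * of_int z / of_nat k)"

lemma unit_root_add: "unit_root k (x + y) = unit_root k x * unit_root k y"
  by (simp add: unit_root_def cis_mult ring_distribs add_divide_distrib)

lemma unit_root_0 [simp]: "unit_root k 0 = 1"
  by (simp add: unit_root_def)

lemma cnj_unit_root: "cnj (unit_root k x) = unit_root k (- x)"
  by (simp add: unit_root_def cis_cnj)

lemma unit_root_power: "unit_root k (int l * z) = unit_root k z ^ l"
  by (simp add: unit_root_def DeMoivre mult_ac)

lemma unit_root_multiple: "0 < k \<Longrightarrow> unit_root k (int k * z) = 1"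
  using cis_multiple_2pi[of "of_int z"] by (simp add: unit_root_def mult.assoc)

lemma unit_root_mod:
  assumes "0 < k" shows "unit_root k (z mod int k) = unit_root k z"
proof -
  have "unit_root k z = unit_root k (int k * (z div int k) + z mod int k)" by simp
  also have "\<dots> = unit_root k (z mod int k)"
    by (simp only: unit_root_add unit_root_multiple[OF assms] mult_1)
  finally show ?thesis by simp
qed

lemma unit_root_cong:
  assumes "0 < k" "x mod int k = y mod int k" shows "unit_root k x = unit_root k y"
  using unit_root_mod[OF assms(1)] assms(2) by metis

lemma unit_root_eq_1_imp:
  assumes k: "0 < k" and "unit_root k z = 1" shows "int k dvd z"
proof -
  have "cos (2 * pi * of_int z / of_nat k) = 1"
    using assms(2) by (simp add: unit_root_def complex_eq_iff)
  then obtain m :: int where "2 * pi * of_int z / of_nat k = of_int m * (2 * pi)"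
    by (auto simp: cos_one_2pi_int)
  then have "(of_int z :: real) = of_int (m * int k)"
    using k by (simp add: field_simps)
  then have "z = m * int k" by (simp only: of_int_eq_iff)
  then show ?thesis by simp
qed

lemma sum_unit_root:
  assumes k: "0 < k"
  shows "(\<Sum>l<k. unit_root k (int l * z)) = (if int k dvd z then of_nat k else 0)"
proof (cases "int k dvd z")
  case True
  then obtain q where "z = int k * q" by blast
  then have "unit_root k z = 1" using unit_root_multiple[OF k] by simp
  then show ?thesis using True by (simp add: unit_root_power)
next
  case False
  then have "unit_root k z \<noteq> 1" using unit_root_eq_1_imp[OF k] by blast
  moreover have "unit_root k z ^ k = 1"
    using unit_root_multiple[OF k] by (simp add: unit_root_power[symmetric])
  ultimately show ?thesis using False by (simp add: unit_root_power geometric_sum)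
qed

lemma sum_unit_root_diff:
  assumes "0 < k" "i < k" "j < k"
  shows "(\<Sum>l<k. unit_root k (int l * (int i - int j))) = (if i = j then of_nat k else 0)"
proof -
  have "int k dvd int i - int j \<longleftrightarrow> int i mod int k = int j mod int k"
    by (simp only: mod_eq_dvd_iff)
  also have "\<dots> \<longleftrightarrow> i = j" using assms by simp
  finally show ?thesis by (simp add: sum_unit_root[OF assms(1)])
qed

lemma fourier_mat_dim [simp]: "fourier_mat k \<in> carrier_mat k k"
  by (simp add: fourier_mat_def)

lemma fourier_mat_nth:
  "i < k \<Longrightarrow> j < k \<Longrightarrow>
     fourier_mat k $$ (i, j) = unit_root k (int i * int j) / complex_of_real (sqrt (real k))"
  by (simp add: fourier_mat_def unit_root_def DeMoivre mult_ac)

lemma mat_adjoint_dim: "M \<in> carrier_mat m n \<Longrightarrow> mat_adjoint M \<in> carrier_mat n m"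
  by (auto simp: mat_adjoint_def)

lemma mat_adjoint_nth:
  "i < dim_col M \<Longrightarrow> j < dim_row M \<Longrightarrow> mat_adjoint M $$ (i, j) = cnj (M $$ (j, i))"
  for M :: "complex mat"
  by (simp add: mat_adjoint_def mat_of_rows_index)

lemma cft_eq_mat_diag:
  "cft (a :: 'k::finite circulant) =
     mat_diag CARD('k) (\<lambda>j. \<Sum>m<CARD('k). periodic_param a (int m) * unit_root CARD('k) (- int m * int j))"
  (is "_ = mat_diag _ ?d")
proof (rule eq_matI)
  let ?k = "CARD('k)"
  let ?F = "fourier_mat ?k"
  let ?e = "unit_root ?k"
  note dims [simp] = carrier_matD[OF circ_dim] carrier_matD[OF fourier_mat_dim]
    carrier_matD[OF mat_adjoint_dim[OF fourier_mat_dim]]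
  show "dim_row (cft a) = dim_row (mat_diag ?k ?d)" "dim_col (cft a) = dim_col (mat_diag ?k ?d)"
    by (simp_all add: cft_def mat_diag_def)
  fix i j assume "i < dim_row (mat_diag ?k ?d)" "j < dim_col (mat_diag ?k ?d)"
  then have i: "i < ?k" and j: "j < ?k" by (simp_all add: mat_diag_def)
  have sq: "complex_of_real (sqrt (real ?k)) * complex_of_real (sqrt (real ?k)) = of_nat ?k"
    by (simp flip: of_real_mult)
  have CF: "(circ a * ?F) $$ (r, j) = ?e (int r * int j) * ?d j / complex_of_real (sqrt (real ?k))"
    if r: "r < ?k" for r
  proof -
    define f where "f y = periodic_param a (int r - y) * ?e (y * int j)" for y
    have "f (y mod int ?k) = f y" for y
    proof -
      have "periodic_param a (int r - y mod int ?k) = periodic_param a (int r - y)"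
        by (rule periodic_param_cong) (simp add: mod_diff_right_eq)
      moreover have "?e (y mod int ?k * int j) = ?e (y * int j)"
        by (rule unit_root_cong) (simp_all add: mod_mult_left_eq)
      ultimately show ?thesis by (simp add: f_def)
    qed
    then have "(\<Sum>l<?k. f (int r + (-1) * int l)) = (\<Sum>l<?k. f (int l))"
      by (intro sum_periodic) auto
    moreover have "f (int r + (-1) * int l) =
        ?e (int r * int j) * (periodic_param a (int l) * ?e (- int l * int j))" for l
      by (simp add: f_def unit_root_add[symmetric] left_diff_distrib mult.left_commute)
    ultimately have "(\<Sum>l<?k. f (int l)) = ?e (int r * int j) * ?d j"
      by (simp add: sum_distrib_left)
    moreover have "(circ a * ?F) $$ (r, j) = (\<Sum>l<?k. f (int l)) / complex_of_real (sqrt (real ?k))"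
      using r j
      by (simp add: scalar_prod_def atLeast0LessThan circ_nth fourier_mat_nth f_def
          sum_divide_distrib)
    ultimately show ?thesis by simp
  qed
  have "cft a = mat_adjoint ?F * (circ a * ?F)"
    unfolding cft_def
    by (rule assoc_mult_mat[OF mat_adjoint_dim[OF fourier_mat_dim] circ_dim fourier_mat_dim])
  then have "cft a $$ (i, j) = (\<Sum>r<?k. cnj (?F $$ (r, i)) * (circ a * ?F) $$ (r, j))"
    using i j by (simp add: scalar_prod_def atLeast0LessThan mat_adjoint_nth)
  also have "\<dots> = (\<Sum>r<?k. ?e (int r * (int j - int i)) * (?d j / of_nat ?k))"
  proof (rule sum.cong)
    fix r assume "r \<in> {..<?k}"
    then have r: "r < ?k" by simp
    have e: "?e (int r * (int j - int i)) = ?e (- (int r * int i)) * ?e (int r * int j)"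
      by (simp add: unit_root_add[symmetric] algebra_simps)
    have "cnj (?F $$ (r, i)) * (circ a * ?F) $$ (r, j) =
        ?e (- (int r * int i)) * ?e (int r * int j) * ?d j /
          (complex_of_real (sqrt (real ?k)) * complex_of_real (sqrt (real ?k)))"
      using r i by (simp only: CF[OF r] fourier_mat_nth complex_cnj_divide complex_cnj_complex_of_real
          cnj_unit_root times_divide_times_eq mult.assoc)
    then show "cnj (?F $$ (r, i)) * (circ a * ?F) $$ (r, j) =
        ?e (int r * (int j - int i)) * (?d j / of_nat ?k)"
      by (simp only: sq e times_divide_eq_right)
  qed simp
  also have "\<dots> = (\<Sum>r<?k. ?e (int r * (int j - int i))) * (?d j / of_nat ?k)"
    by (simp only: sum_distrib_right)
  also have "\<dots> = mat_diag ?k ?d $$ (i, j)"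
    using i j by (simp only: sum_unit_root_diff[OF CARD_pos j i]) (simp add: mat_diag_def)
  finally show "cft a $$ (i, j) = mat_diag ?k ?d $$ (i, j)" .
qed

lemma fcoeff_eq:
  "j < CARD('k) \<Longrightarrow> fcoeff j (a :: 'k::finite circulant) =
     (\<Sum>m<CARD('k). periodic_param a (int m) * unit_root CARD('k) (- int m * int j))"
  unfolding fcoeff_def cft_eq_mat_diag by (simp add: mat_diag_def)

lemma cft_diag: "cft (a :: 'k::finite circulant) = mat_diag CARD('k) (\<lambda>j. fcoeff j a)"
  by (subst cft_eq_mat_diag, rule eq_matI) (auto simp: mat_diag_def fcoeff_eq)

lemma fourier_inversion:
  assumes i: "i < CARD('k)"
  shows "(\<Sum>j<CARD('k). fcoeff j a * unit_root CARD('k) (int j * int i)) =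
    of_nat CARD('k) * params (a :: 'k::finite circulant) $ i"
proof -
  let ?k = "CARD('k)"
  have "(\<Sum>j<?k. fcoeff j a * unit_root ?k (int j * int i)) =
      (\<Sum>j<?k. \<Sum>m<?k. periodic_param a (int m) * unit_root ?k (int j * (int i - int m)))"
    by (simp add: fcoeff_eq sum_distrib_right mult.assoc unit_root_add[symmetric])
       (simp add: algebra_simps)
  also have "\<dots> = (\<Sum>m<?k. periodic_param a (int m) * (\<Sum>j<?k. unit_root ?k (int j * (int i - int m))))"
    by (subst sum.swap) (simp only: sum_distrib_left)
  also have "\<dots> = (\<Sum>m<?k. if m = i then of_nat ?k * periodic_param a (int m) else 0)"
    by (rule sum.cong) (use i in \<open>auto simp: sum_unit_root_diff\<close>)
  also have "\<dots> = of_nat ?k * params a $ i"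
    using i by (simp add: params_nth)
  finally show ?thesis .
qed

lemma cft_bij: "\<exists>!b :: 'k::finite circulant. cft b = mat_diag CARD('k) d"
proof -
  let ?k = "CARD('k)"
  define b :: "'k circulant" where
    "b = Circulant (Matrix.vec ?k (\<lambda>m. (\<Sum>i<?k. d i * unit_root ?k (int i * int m)) / of_nat ?k))"
  have "fcoeff j b = d j" if j: "j < ?k" for j
  proof -
    have "fcoeff j b = (\<Sum>m<?k. (\<Sum>i<?k. d i * unit_root ?k (int i * int m)) / of_nat ?k *
        unit_root ?k (- int m * int j))"
      unfolding fcoeff_eq[OF j] b_def
      by (rule sum.cong) (simp_all add: periodic_param_Circulant)
    also have "\<dots> = (\<Sum>m<?k. \<Sum>i<?k. d i / of_nat ?k * unit_root ?k (int m * (int i - int j)))"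
      by (simp add: sum_distrib_right sum_divide_distrib mult.assoc unit_root_add[symmetric])
         (simp add: algebra_simps)
    also have "\<dots> = (\<Sum>i<?k. d i / of_nat ?k * (\<Sum>m<?k. unit_root ?k (int m * (int i - int j))))"
      by (subst sum.swap) (simp only: sum_distrib_left)
    also have "\<dots> = (\<Sum>i<?k. if i = j then d i else 0)"
      by (rule sum.cong) (use j in \<open>auto simp: sum_unit_root_diff\<close>)
    also have "\<dots> = d j" using j by simp
    finally show ?thesis .
  qed
  then have "cft b = mat_diag ?k d"
    by (subst cft_diag, intro eq_matI) (auto simp: mat_diag_def)
  moreover have "b1 = b2" if "cft b1 = cft b2" for b1 b2 :: "'k circulant"
  proof -
    have "params b1 = params b2"
    proof (rule eq_vecI)
      fix i assume "i < dim_vec (params b2)"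
      then have i: "i < ?k" by simp
      have "fcoeff j b1 = fcoeff j b2" for j by (simp add: fcoeff_def that)
      then have "of_nat ?k * params b1 $ i = of_nat ?k * params b2 $ i"
        using fourier_inversion[OF i, of b1] fourier_inversion[OF i, of b2] by simp
      then show "params b1 $ i = params b2 $ i" by simp
    qed simp
    then show ?thesis by (simp add: params_inject)
  qed
  ultimately show ?thesis by metis
qed

text \<open>The \<open>j\<close>-th diagonal block of \<open>cft\<close> of a matrix and of a vector.\<close>

definition cft_mat_block :: "nat \<Rightarrow> 'k::finite circulant mat \<Rightarrow> complex mat" where
  "cft_mat_block j A = map_mat (fcoeff j) A"

definition cft_vec_block :: "nat \<Rightarrow> 'k::finite circulant Matrix.vec \<Rightarrow> complex Matrix.vec" where
  "cft_vec_block j x = map_vec (fcoeff j) x"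

definition circ_abs :: "'k::finite circulant \<Rightarrow> 'k circulant" where
  "circ_abs a =
     (THE b. cft b = mat_diag CARD('k) (\<lambda>j. complex_of_real (cmod (fcoeff j a))))"

lemma cft_circ_abs:
  "cft (circ_abs (a :: 'k::finite circulant)) =
     mat_diag CARD('k) (\<lambda>j. complex_of_real (cmod (fcoeff j a)))"
  unfolding circ_abs_def by (rule theI'[OF cft_bij])

definition circ_le :: "'k::finite circulant \<Rightarrow> 'k circulant \<Rightarrow> bool" where
  "circ_le a b \<longleftrightarrow>
     (\<forall>j<CARD('k). fcoeff j a \<in> \<real> \<and> fcoeff j b \<in> \<real> \<and> Re (fcoeff j a) \<le> Re (fcoeff j b))"

definition circ_eigenpair ::
  "'k::finite circulant mat \<Rightarrow> 'k circulant \<Rightarrow> 'k circulant Matrix.vec \<Rightarrow> bool" where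
  "circ_eigenpair A l x \<longleftrightarrow>
     det (A - l \<cdot>\<^sub>m 1\<^sub>m (dim_row A)) = 0 \<and>
     x \<in> carrier_vec (dim_row A) \<and>
     A *\<^sub>v x = l \<cdot>\<^sub>v x \<and>
     (\<forall>j<CARD('k). cft_vec_block j x \<noteq> 0\<^sub>v (dim_row A))"

text \<open>
  A finite collection of eigenpairs is represented by the list of its members, in the order
  of their numbering. Minimality of the size is taken over all reproducing collections,
  whether or not their members can be ordered by absolute value.
\<close>

definition reproducing ::
  "'k::finite circulant mat \<Rightarrow> ('k circulant \<times> 'k circulant Matrix.vec) list \<Rightarrow> bool" where
  "reproducing A ps \<longleftrightarrow>
     (\<forall>(l, x) \<in> set ps. circ_eigenpair A l x) \<and>
     (\<forall>j<CARD('k). \<forall>\<mu> v. eigenvector (cft_mat_block j A) v \<mu> \<longrightarrow>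
        (\<exists>(l, x) \<in> set ps. fcoeff j l = \<mu> \<and>
           (\<exists>c. c \<noteq> 0 \<and> v = c \<cdot>\<^sub>v cft_vec_block j x)))"

definition canonical_set ::
  "'k::finite circulant mat \<Rightarrow> ('k circulant \<times> 'k circulant Matrix.vec) list \<Rightarrow> bool" where
  "canonical_set A ps \<longleftrightarrow>
     reproducing A ps \<and>
     sorted_wrt (\<lambda>(l, _) (l', _). circ_le (circ_abs l') (circ_abs l)) ps \<and>
     (\<forall>qs. reproducing A qs \<longrightarrow> length ps \<le> length qs)"

definition same_up_to_normalization ::
  "('k::finite circulant \<times> 'k circulant Matrix.vec) \<Rightarrow>
   ('k circulant \<times> 'k circulant Matrix.vec) \<Rightarrow> bool" where
  "same_up_to_normalization p q \<longleftrightarrow>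
     fst p = fst q \<and> (\<exists>u. u dvd 1 \<and> snd p = u \<cdot>\<^sub>v snd q)"

definition free_basis :: "nat \<Rightarrow> 'a::comm_ring_1 Matrix.vec list \<Rightarrow> bool" where
  "free_basis n xs \<longleftrightarrow>
     distinct xs \<and> set xs \<subseteq> carrier_vec n \<and>
     LinearCombinations.module.lin_indpt class_ring (module_vec TYPE('a) n) (set xs) \<and>
     LinearCombinations.module.gen_set class_ring (module_vec TYPE('a) n) (set xs)"

end

theory Submission
  imports Defs
begin

text \<open>
  The maps \<open>fcoeff j\<close> are ring homomorphisms to the complex numbers that together identify
  the circulants with tuples of \<open>CARD('k)\<close> complex numbers, so eigenpairs of \<open>A\<close> are tuples of
  eigenpairs of its blocks. Each block has \<open>n\<close> distinct eigenvalues of distinct moduli, hence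
  one-dimensional eigenspaces and a unique enumeration of its spectrum by decreasing modulus.
  A single block already forces a reproducing collection to have at least \<open>n\<close> members;
  gluing the enumerations of all blocks attains this bound. A collection of \<open>n\<close> members
  enumerates every spectrum without repetition, so the ordering determines the eigenvalues,
  and the eigenvectors are determined up to a nonzero scalar in each block, i.e. up to a unit.
  Eigenvectors of distinct eigenvalues being independent, every block of \<open>X\<close> has nonzero
  determinant; therefore \<open>det X\<close> is a unit and \<open>X\<close> is invertible.
\<close>

subsection \<open>Eigenvectors of distinct eigenvalues over a field\<close>

text \<open>
  Applying \<open>A - \<mu> k\<close> to the sum removes the
  \<open>k\<close>-th summand and scales the others by the nonzero factors \<open>\<mu> i - \<mu> k\<close>.
\<close>

lemma eigenspaces_independent:
  fixes A :: "'a::field mat"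
  assumes "finite I" "inj_on \<mu> I" "A \<in> carrier_mat n n"
    and "\<And>i. i \<in> I \<Longrightarrow> w i \<in> carrier_vec n"
    and "\<And>i. i \<in> I \<Longrightarrow> A *\<^sub>v w i = \<mu> i \<cdot>\<^sub>v w i"
    and "\<And>r. r < n \<Longrightarrow> (\<Sum>i\<in>I. w i $ r) = 0"
  shows "\<forall>i\<in>I. w i = 0\<^sub>v n"
  using assms
proof (induction I arbitrary: w rule: finite_induct)
  case empty
  then show ?case by simp
next
  case (insert k I)
  note A = insert.prems(2)
  have w: "w i \<in> carrier_vec n" "A *\<^sub>v w i = \<mu> i \<cdot>\<^sub>v w i" if "i \<in> insert k I" for i
    using insert.prems(3,4) that by blast+
  have sum0: "(\<Sum>i\<in>insert k I. w i $ r) = 0" if "r < n" for r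
    using insert.prems(5) that by blast
  \<comment> \<open>The vectors add up to zero, hence so do their images under \<open>A\<close>; on
    the \<open>i\<close>-th of them \<open>A\<close> acts as the scalar
    \<open>\<mu> i\<close>.\<close>
  have weighted: "(\<Sum>i\<in>insert k I. \<mu> i * w i $ r) = 0" if r: "r < n" for r
  proof -
    have "(\<Sum>i\<in>insert k I. \<mu> i * w i $ r) = (\<Sum>i\<in>insert k I. \<Sum>s<n. A $$ (r, s) * w i $ s)"
    proof (rule sum.cong)
      fix i assume i: "i \<in> insert k I"
      have "\<mu> i * w i $ r = (A *\<^sub>v w i) $ r" using w[OF i] r by simp
      also have "\<dots> = (\<Sum>s<n. A $$ (r, s) * w i $ s)"
        using A w(1)[OF i] r by (auto simp: scalar_prod_def atLeast0LessThan)
      finally show "\<mu> i * w i $ r = (\<Sum>s<n. A $$ (r, s) * w i $ s)" .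
    qed simp
    also have "\<dots> = (\<Sum>s<n. A $$ (r, s) * (\<Sum>i\<in>insert k I. w i $ s))"
      by (subst sum.swap) (simp only: sum_distrib_left)
    also have "\<dots> = 0" by (rule sum.neutral) (use sum0 in auto)
    finally show ?thesis .
  qed
  let ?w = "\<lambda>i. (\<mu> i - \<mu> k) \<cdot>\<^sub>v w i"
  have scaled: "\<forall>i\<in>I. ?w i = 0\<^sub>v n"
  proof (rule insert.IH)
    show "inj_on \<mu> I" using insert.prems(1) by auto
    show "?w i \<in> carrier_vec n" if "i \<in> I" for i using w that by simp
    show "A *\<^sub>v ?w i = \<mu> i \<cdot>\<^sub>v ?w i" if "i \<in> I" for i
      using w[of i] that A by (simp add: mult_mat_vec smult_smult_assoc mult.commute)
    fix r assume r: "r < n"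
    have "?w i $ r = (\<mu> i - \<mu> k) * w i $ r" if "i \<in> I" for i
      using w(1)[of i] that r by simp
    then have "(\<Sum>i\<in>I. ?w i $ r) = (\<Sum>i\<in>insert k I. (\<mu> i - \<mu> k) * w i $ r)"
      using insert.hyps by simp
    also have "\<dots> = (\<Sum>i\<in>insert k I. \<mu> i * w i $ r) - \<mu> k * (\<Sum>i\<in>insert k I. w i $ r)"
      by (simp only: left_diff_distrib sum_subtractf sum_distrib_left)
    also have "\<dots> = 0" by (simp only: weighted[OF r] sum0[OF r]) simp
    finally show "(\<Sum>i\<in>I. ?w i $ r) = 0" .
  qed (rule A)
  have distinct: "\<mu> i \<noteq> \<mu> k" if "i \<in> I" for i
    using insert.prems(1) insert.hyps(2) that by (auto simp: inj_on_def)
  have I0: "w i = 0\<^sub>v n" if i: "i \<in> I" for i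
  proof -
    have "(\<mu> i - \<mu> k) * w i $ r = 0" if "r < n" for r
    proof -
      have "((\<mu> i - \<mu> k) \<cdot>\<^sub>v w i) $ r = 0"
        using scaled i that by simp
      then show ?thesis using w(1)[of i] i that by simp
    qed
    then show ?thesis using distinct[OF i] w(1)[of i] i
      by (intro eq_vecI) auto
  qed
  have "w k $ r = 0" if "r < n" for r
    using sum0[OF that] insert.hyps I0 that by simp
  then have "w k = 0\<^sub>v n" using w(1)[of k] by (intro eq_vecI) auto
  then show ?case using I0 by simp
qed

text \<open>Brings a matrix-vector product into the coordinatewise form of a sum of vectors to which
  \<open>eigenspaces_independent\<close> applies.\<close>

lemma mat_of_cols_mult_vec_nth:
  fixes vs :: "'a::comm_ring_1 Matrix.vec list"
  assumes "length vs = n" "\<And>i. i < n \<Longrightarrow> vs ! i \<in> carrier_vec n" "c \<in> carrier_vec n" "r < n"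
  shows "(mat_of_cols n vs *\<^sub>v c) $ r = (\<Sum>i<n. (c $ i \<cdot>\<^sub>v vs ! i) $ r)"
proof -
  have "(mat_of_cols n vs *\<^sub>v c) $ r = (\<Sum>i<n. vs ! i $ r * c $ i)"
    using assms by (auto simp: scalar_prod_def atLeast0LessThan mat_of_cols_index)
  also have "\<dots> = (\<Sum>i<n. (c $ i \<cdot>\<^sub>v vs ! i) $ r)"
    using assms(2)[unfolded carrier_vec_def] assms(4) by (intro sum.cong) (auto simp: mult.commute)
  finally show ?thesis .
qed

lemma eigenvector_carrier:
  "eigenvector A v k \<Longrightarrow> A \<in> carrier_mat n n \<Longrightarrow> v \<in> carrier_vec n"
  by (auto simp: eigenvector_def)

text \<open>A kernel vector \<open>c\<close> would give multiples
  \<open>c $ i \<cdot>\<^sub>v vs ! i\<close> from different eigenspaces with sum zero. Independence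
  kills each multiple, and as eigenvectors are nonzero, each \<open>c $ i\<close>.\<close>

lemma det_eigenvectors_nonzero:
  fixes A :: "'a::field mat"
  assumes A: "A \<in> carrier_mat n n" and len: "length vs = n" and inj: "inj_on \<mu> {..<n}"
    and ev: "\<And>i. i < n \<Longrightarrow> eigenvector A (vs ! i) (\<mu> i)"
  shows "det (mat_of_cols n vs) \<noteq> 0"
proof
  assume "det (mat_of_cols n vs) = 0"
  moreover have M: "mat_of_cols n vs \<in> carrier_mat n n" using len by auto
  ultimately obtain c where c: "c \<in> carrier_vec n" "c \<noteq> 0\<^sub>v n" "mat_of_cols n vs *\<^sub>v c = 0\<^sub>v n"
    using det_0_iff_vec_prod_zero_field[OF M] by blast
  have vs: "vs ! i \<in> carrier_vec n" "A *\<^sub>v vs ! i = \<mu> i \<cdot>\<^sub>v vs ! i" "vs ! i \<noteq> 0\<^sub>v n"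
    if "i < n" for i
    using ev[OF that] A by (auto simp: eigenvector_def)
  have zero: "\<forall>i\<in>{..<n}. c $ i \<cdot>\<^sub>v vs ! i = 0\<^sub>v n"
  proof (rule eigenspaces_independent[OF _ inj A])
    show "A *\<^sub>v (c $ i \<cdot>\<^sub>v vs ! i) = \<mu> i \<cdot>\<^sub>v (c $ i \<cdot>\<^sub>v vs ! i)" if "i \<in> {..<n}" for i
      using vs[of i] that A by (simp add: mult_mat_vec smult_smult_assoc mult.commute)
    show "(\<Sum>i<n. (c $ i \<cdot>\<^sub>v vs ! i) $ r) = 0" if "r < n" for r
      using mat_of_cols_mult_vec_nth[OF len vs(1) c(1) that] c(3) that by simp
  qed (use vs in auto)
  have "c $ i = 0" if "i < n" for i
  proof (rule ccontr)
    assume "c $ i \<noteq> 0"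
    moreover have "c $ i \<cdot>\<^sub>v vs ! i = 0\<^sub>v n" using zero that by simp
    then have "c $ i * vs ! i $ r = 0" if "r < n" for r
      using vs(1)[OF \<open>i < n\<close>] that by (metis carrier_vecD index_smult_vec(1) index_zero_vec(1))
    ultimately have "vs ! i = 0\<^sub>v n" using vs(1)[OF that] by (intro eq_vecI) auto
    with vs(3)[OF that] show False ..
  qed
  then have "c = 0\<^sub>v n" using c(1) by (intro eq_vecI) auto
  with c(2) show False ..
qed

text \<open>The \<open>n\<close> eigenvectors form a basis because their determinant is nonzero.
  Expanding \<open>u\<close> in it, only the \<open>k\<close>-th term can survive, since
  \<open>u\<close> lies in the \<open>k\<close>-th eigenspace.\<close>

lemma eigenvector_unique_up_to_scaling:
  fixes A :: "'a::field mat"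
  assumes A: "A \<in> carrier_mat n n" and len: "length vs = n" and inj: "inj_on \<mu> {..<n}"
    and ev: "\<And>i. i < n \<Longrightarrow> eigenvector A (vs ! i) (\<mu> i)"
    and k: "k < n" and u: "eigenvector A u (\<mu> k)"
  shows "\<exists>c. c \<noteq> 0 \<and> u = c \<cdot>\<^sub>v vs ! k"
proof -
  let ?M = "mat_of_cols n vs"
  have M: "?M \<in> carrier_mat n n" using len by auto
  have "det ?M \<noteq> 0" by (rule det_eigenvectors_nonzero[OF A len inj ev])
  \<comment> \<open>Invertibility is obtained as being a unit of the matrix ring; \<open>()\<close>
    fills the extension slot of the ring record.\<close>
  from det_non_zero_imp_unit[OF M this, of "()"]
  obtain N where N: "N \<in> carrier_mat n n" "?M * N = 1\<^sub>m n"
    unfolding Units_def by (auto simp: ring_mat_simps)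
  have uc: "u \<in> carrier_vec n" "u \<noteq> 0\<^sub>v n" "A *\<^sub>v u = \<mu> k \<cdot>\<^sub>v u"
    using u A by (auto simp: eigenvector_def)
  define c where "c = N *\<^sub>v u"
  have c: "c \<in> carrier_vec n" using N(1) uc(1) by (simp add: c_def)
  have "?M *\<^sub>v c = (?M * N) *\<^sub>v u"
    unfolding c_def by (rule assoc_mult_mat_vec[symmetric, OF M N(1) uc(1)])
  then have Mc: "?M *\<^sub>v c = u" using N(2) uc(1) by simp
  have vs: "vs ! i \<in> carrier_vec n" "A *\<^sub>v vs ! i = \<mu> i \<cdot>\<^sub>v vs ! i" if "i < n" for i
    using ev[OF that] A by (auto simp: eigenvector_def)
  \<comment> \<open>The expansion of \<open>u\<close> with \<open>u\<close> moved to the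
    \<open>k\<close>-th term: each \<open>w i\<close> still satisfies the eigenvector equation for
    \<open>\<mu> i\<close>, and the sum is now zero.\<close>
  define w where "w i = c $ i \<cdot>\<^sub>v vs ! i - (if i = k then u else 0\<^sub>v n)" for i
  have wr: "w i $ r = (c $ i \<cdot>\<^sub>v vs ! i) $ r - (if i = k then u $ r else 0)"
    if "i < n" "r < n" for i r
    using that vs(1)[of i] uc(1) by (simp add: w_def)
  have "\<forall>i\<in>{..<n}. w i = 0\<^sub>v n"
  proof (rule eigenspaces_independent[OF _ inj A])
    fix i assume "i \<in> {..<n}"
    then have i: "i < n" by simp
    show "w i \<in> carrier_vec n" using vs(1)[OF i] uc(1) by (simp add: w_def)
    show "A *\<^sub>v w i = \<mu> i \<cdot>\<^sub>v w i"
    proof -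
      let ?z = "if i = k then u else 0\<^sub>v n"
      have z: "?z \<in> carrier_vec n" "A *\<^sub>v ?z = \<mu> i \<cdot>\<^sub>v ?z" using uc A by auto
      have "A *\<^sub>v w i = A *\<^sub>v (c $ i \<cdot>\<^sub>v vs ! i) - A *\<^sub>v ?z"
        unfolding w_def by (rule mult_minus_distrib_mat_vec[OF A _ z(1)]) (use vs(1)[OF i] in simp)
      also have "\<dots> = \<mu> i \<cdot>\<^sub>v (c $ i \<cdot>\<^sub>v vs ! i) - \<mu> i \<cdot>\<^sub>v ?z"
        by (simp only: z(2) mult_mat_vec[OF A vs(1)[OF i]] vs(2)[OF i] smult_smult_assoc mult.commute)
      also have "\<dots> = \<mu> i \<cdot>\<^sub>v w i"
        unfolding w_def using vs(1)[OF i] z(1) by (intro eq_vecI) (auto simp: right_diff_distrib)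
      finally show ?thesis .
    qed
  next
    fix r assume r: "r < n"
    have "(\<Sum>i<n. w i $ r) = (\<Sum>i<n. (c $ i \<cdot>\<^sub>v vs ! i) $ r) - (\<Sum>i<n. if i = k then u $ r else 0)"
      unfolding sum_subtractf[symmetric] by (rule sum.cong) (use wr r in auto)
    also have "\<dots> = 0"
      using mat_of_cols_mult_vec_nth[OF len vs(1) c r] Mc k by simp
    finally show "(\<Sum>i<n. w i $ r) = 0" .
  qed simp
  then have w0: "w k = 0\<^sub>v n" using k by simp
  have uk: "u = c $ k \<cdot>\<^sub>v vs ! k"
  proof (rule eq_vecI)
    fix r assume "r < dim_vec (c $ k \<cdot>\<^sub>v vs ! k)"
    then have "r < n" using vs(1)[OF k] by simp
    then show "u $ r = (c $ k \<cdot>\<^sub>v vs ! k) $ r" using wr[OF k, of r] w0 by simp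
  qed (use vs(1)[OF k] uc(1) in simp)
  moreover have "c $ k \<noteq> 0" using uk uc(2) vs(1)[OF k] by auto
  ultimately show ?thesis by blast
qed

subsection \<open>Bases from invertible matrices\<close>

text \<open>Cramer's rule over a commutative ring: the adjugate divided by the determinant.\<close>

lemma inverse_of_unit_det:
  fixes X :: "'a::comm_ring_1 mat"
  assumes X: "X \<in> carrier_mat n n" and "det X dvd 1"
  obtains Y where "Y \<in> carrier_mat n n" "X * Y = 1\<^sub>m n" "Y * X = 1\<^sub>m n"
proof -
  obtain u where u: "1 = det X * u" using assms(2) by (rule dvdE)
  note adj = adj_mat[OF X]
  show thesis
  proof (rule that[of "u \<cdot>\<^sub>m adj_mat X"])
    show "u \<cdot>\<^sub>m adj_mat X \<in> carrier_mat n n" using adj(1) by simp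
    have "X * (u \<cdot>\<^sub>m adj_mat X) = u \<cdot>\<^sub>m (det X \<cdot>\<^sub>m 1\<^sub>m n)"
      using mult_smult_distrib[OF X adj(1)] adj(2) by simp
    then show "X * (u \<cdot>\<^sub>m adj_mat X) = 1\<^sub>m n" using u by (auto simp: mult.commute)
    have "u \<cdot>\<^sub>m adj_mat X * X = u \<cdot>\<^sub>m (det X \<cdot>\<^sub>m 1\<^sub>m n)"
      using mult_smult_assoc_mat[OF adj(1) X] adj(3) by simp
    then show "u \<cdot>\<^sub>m adj_mat X * X = 1\<^sub>m n" using u by (auto simp: mult.commute)
  qed
qed

text \<open>The left inverse makes the kernel of the column matrix trivial, which gives
  independence; the right inverse supplies the coordinates \<open>Y *\<^sub>v v\<close> of any
  \<open>v\<close>, which gives generation.\<close>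

lemma free_basis_of_invertible:
  fixes xs :: "'a::comm_ring_1 Matrix.vec list"
  assumes len: "length xs = n" and xs: "set xs \<subseteq> carrier_vec n"
    and Y: "Y \<in> carrier_mat n n" and XY: "mat_of_cols n xs * Y = 1\<^sub>m n"
    and YX: "Y * mat_of_cols n xs = 1\<^sub>m n"
  shows "free_basis n xs"
proof -
  interpret vec_module "TYPE('a)" n .
  let ?X = "mat_of_cols n xs"
  have X: "?X \<in> carrier_mat n n" using len by auto
  have cancel: "v = 0\<^sub>v n" if "v \<in> carrier_vec n" "?X *\<^sub>v v = 0\<^sub>v n" for v
  proof -
    have "v = (Y * ?X) *\<^sub>v v" using that(1) by (simp add: YX)
    also have "\<dots> = Y *\<^sub>v (?X *\<^sub>v v)" by (rule assoc_mult_mat_vec[OF Y X that(1)])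
    also have "\<dots> = 0\<^sub>v n" using that(2) Y by auto
    finally show ?thesis .
  qed
  have dist: "distinct xs"
  proof (rule ccontr)
    assume "\<not> distinct xs"
    then obtain i j where ij: "i < n" "j < n" "i \<noteq> j" "xs ! i = xs ! j"
      using len by (auto simp: distinct_conv_nth)
    \<comment> \<open>Equal columns of \<open>?X\<close> would produce two equal columns of the
      identity matrix.\<close>
    have "col (Y * ?X) i = col (Y * ?X) j"
      using ij xs len by (simp add: col_mult2[OF Y X] subset_code(1))
    then have "unit_vec n i $ i = (unit_vec n j $ i :: 'a)" using ij by (simp add: YX)
    then show False using ij by simp
  qed
  have lc: "lincomb f (set xs) = ?X *\<^sub>v Matrix.vec n (\<lambda>i. f (xs ! i))" for f
  proof -
    have "\<forall>x\<in>set xs. dim_vec x = n" using xs by auto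
    from lincomb_list_as_mat_mult[OF this] show ?thesis
      by (simp only: lincomb_as_lincomb_list_distinct[OF xs dist] len)
  qed
  have "lin_indpt (set xs)"
  proof
    assume "lin_dep (set xs)"
    from finite_lin_dep[OF _ this] xs obtain a v
      where a: "lincomb a (set xs) = 0\<^sub>v n" "v \<in> set xs" "a v \<noteq> 0" by auto
    from a(2) len obtain i where i: "i < n" "v = xs ! i" by (auto simp: in_set_conv_nth)
    have "Matrix.vec n (\<lambda>i. a (xs ! i)) = 0\<^sub>v n" by (rule cancel) (use a(1) lc in auto)
    then have "Matrix.vec n (\<lambda>i. a (xs ! i)) $ i = 0" using i by simp
    then show False using a(3) i by simp
  qed
  moreover have "span (set xs) = carrier_vec n"
  proof
    show "span (set xs) \<subseteq> carrier_vec n" by (rule span_is_subset2[OF xs])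
    show "carrier_vec n \<subseteq> span (set xs)"
    proof
      fix v :: "'a Matrix.vec" assume v: "v \<in> carrier_vec n"
      \<comment> \<open>\<open>lincomb\<close> takes coefficients indexed by vectors, not by
        positions; as \<open>xs\<close> has no repetitions, the position can be recovered from the
        vector.\<close>
      let ?f = "\<lambda>x. (Y *\<^sub>v v) $ (THE i. i < n \<and> xs ! i = x)"
      have "(THE i'. i' < n \<and> xs ! i' = xs ! i) = i" if "i < n" for i
        by (rule the_equality) (use that dist len in \<open>auto simp: nth_eq_iff_index_eq\<close>)
      then have "Matrix.vec n (\<lambda>i. ?f (xs ! i)) = Y *\<^sub>v v" using Y by (intro eq_vecI) auto
      then have "lincomb ?f (set xs) = ?X *\<^sub>v (Y *\<^sub>v v)" by (simp add: lc)
      also have "\<dots> = (?X * Y) *\<^sub>v v" by (rule assoc_mult_mat_vec[symmetric, OF X Y v])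
      also have "\<dots> = v" using v by (simp add: XY)
      finally have "v = lincomb ?f (set xs)" ..
      then show "v \<in> span (set xs)" unfolding span_def by blast
    qed
  qed
  ultimately show ?thesis using dist xs by (simp add: free_basis_def module_vec_simps)
qed

subsection \<open>Fourier coefficients as ring homomorphisms\<close>

lemma fcoeff_plus:
  "j < CARD('k) \<Longrightarrow> fcoeff j (a + b) = fcoeff j a + fcoeff j (b :: 'k::finite circulant)"
  by (simp add: fcoeff_eq distrib_right sum.distrib)

lemma fcoeff_zero: "j < CARD('k) \<Longrightarrow> fcoeff j (0 :: 'k::finite circulant) = 0"
  by (simp add: fcoeff_eq)

text \<open>The product of circulants is cyclic convolution, which the discrete Fourier transform
  turns into multiplication: the root of unity at \<open>m\<close> splits into those at
  \<open>m - l\<close> and \<open>l\<close>, and the sum over a full period does not change under a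
  shift by \<open>l\<close>.\<close>

lemma fcoeff_times:
  assumes j: "j < CARD('k)"
  shows "fcoeff j (a * b) = fcoeff j a * fcoeff j (b :: 'k::finite circulant)"
proof -
  let ?k = "CARD('k)" and ?e = "unit_root CARD('k)"
  define f where "f y = periodic_param a y * ?e (- y * int j)" for y
  have "f (y mod int ?k) = f y" for y
  proof -
    have "?e (- (y mod int ?k) * int j) = ?e (- y * int j)"
      by (rule unit_root_cong) (simp_all, metis mod_minus_eq mod_mult_left_eq mult_minus_left)
    then show ?thesis by (simp add: f_def)
  qed
  then have shift: "(\<Sum>m<?k. f (c + 1 * int m)) = (\<Sum>m<?k. f (int m))" for c
    by (intro sum_periodic) auto
  have "fcoeff j (a * b) =
      (\<Sum>m<?k. \<Sum>l<?k. f (int m - int l) * (periodic_param b (int l) * ?e (- int l * int j)))"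
    unfolding fcoeff_eq[OF j] periodic_param_times sum_distrib_right
  proof (intro sum.cong refl)
    fix m l
    have "- int m * int j = - (int m - int l) * int j + - int l * int j"
      by (simp add: algebra_simps)
    then have "?e (- int m * int j) = ?e (- (int m - int l) * int j) * ?e (- int l * int j)"
      by (simp only: unit_root_add)
    then show "periodic_param a (int m - int l) * periodic_param b (int l) * ?e (- int m * int j) =
        f (int m - int l) * (periodic_param b (int l) * ?e (- int l * int j))"
      by (simp only: f_def mult_ac)
  qed
  also have "\<dots> = (\<Sum>l<?k. (\<Sum>m<?k. f (- int l + 1 * int m)) *
      (periodic_param b (int l) * ?e (- int l * int j)))"
    by (subst sum.swap) (simp add: sum_distrib_right)
  also have "\<dots> = fcoeff j a * fcoeff j b"
    by (simp only: shift sum_distrib_left[symmetric]) (simp only: fcoeff_eq[OF j] f_def)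
  finally show ?thesis .
qed

lemma fcoeff_one:
  assumes j: "j < CARD('k)" shows "fcoeff j (1 :: 'k::finite circulant) = 1"
proof -
  have "fcoeff j (1 :: 'k circulant) = (\<Sum>m<CARD('k). if m = 0 then 1 else 0)"
    unfolding fcoeff_eq[OF j]
    by (rule sum.cong) (auto simp: periodic_param_one unit_root_def)
  also have "\<dots> = 1" by simp
  finally show ?thesis .
qed

lemma comm_ring_hom_fcoeff:
  assumes "j < CARD('k)"
  shows "comm_ring_hom (fcoeff j :: 'k::finite circulant \<Rightarrow> complex)"
  using assms by unfold_locales (simp_all add: fcoeff_plus fcoeff_zero fcoeff_times fcoeff_one)

text \<open>The uniqueness half of \<open>cft_bij\<close>: identities between circulants may be
  checked one Fourier coefficient at a time.\<close>

lemma fcoeff_eqI: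
  fixes a b :: "'k::finite circulant"
  assumes "\<And>j. j < CARD('k) \<Longrightarrow> fcoeff j a = fcoeff j b"
  shows "a = b"
proof -
  have "cft a = cft b"
    unfolding cft_diag by (rule eq_matI) (auto simp: mat_diag_def assms)
  then show ?thesis
    using cft_bij[of "\<lambda>j. fcoeff j b", where 'k = 'k] cft_diag[of b] by metis
qed

text \<open>The inverse Fourier transform, well defined by \<open>cft_bij\<close>. It glues data
  chosen separately in each block into one circulant.\<close>

definition of_fcoeffs :: "(nat \<Rightarrow> complex) \<Rightarrow> 'k::finite circulant" where
  "of_fcoeffs d = (THE b. cft b = mat_diag CARD('k) d)"

lemma fcoeff_of_fcoeffs:
  assumes "j < CARD('k)" shows "fcoeff j (of_fcoeffs d :: 'k::finite circulant) = d j"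
proof -
  have "cft (of_fcoeffs d :: 'k circulant) = mat_diag CARD('k) d"
    unfolding of_fcoeffs_def by (rule theI'[OF cft_bij])
  then show ?thesis using assms by (simp add: fcoeff_def mat_diag_def)
qed

text \<open>The circulants form a product of \<open>CARD('k)\<close> copies of the complex numbers,
  where inverses are taken coordinatewise.\<close>

lemma dvd_one_iff_fcoeff:
  "(a :: 'k::finite circulant) dvd 1 \<longleftrightarrow> (\<forall>j<CARD('k). fcoeff j a \<noteq> 0)"
proof
  assume "a dvd 1"
  then obtain b where "1 = a * b" by (rule dvdE)
  then have "fcoeff j a * fcoeff j b = 1" if "j < CARD('k)" for j
    using that by (metis fcoeff_one fcoeff_times)
  then show "\<forall>j<CARD('k). fcoeff j a \<noteq> 0" by force
next
  assume "\<forall>j<CARD('k). fcoeff j a \<noteq> 0"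
  then have "1 = a * of_fcoeffs (\<lambda>j. inverse (fcoeff j a))"
    by (intro fcoeff_eqI) (simp add: fcoeff_one fcoeff_times fcoeff_of_fcoeffs)
  then show "a dvd 1" by (rule dvdI)
qed

lemma circ_le_circ_abs_iff:
  fixes a b :: "'k::finite circulant"
  shows "circ_le (circ_abs a) (circ_abs b) \<longleftrightarrow> (\<forall>j<CARD('k). cmod (fcoeff j a) \<le> cmod (fcoeff j b))"
proof -
  have "fcoeff j (circ_abs c) = complex_of_real (cmod (fcoeff j c))"
    if "j < CARD('k)" for j and c :: "'k circulant"
    using that by (simp add: fcoeff_def[of j "circ_abs c"] cft_circ_abs) (simp add: mat_diag_def)
  then show ?thesis by (auto simp: circ_le_def)
qed

section \<open>Fourier blocks of vectors, matrices and eigenpairs\<close>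

lemma circulant_vec_eqI:
  fixes x y :: "'k::finite circulant Matrix.vec"
  assumes "x \<in> carrier_vec n" "y \<in> carrier_vec n"
    and "\<And>j. j < CARD('k) \<Longrightarrow> cft_vec_block j x = cft_vec_block j y"
  shows "x = y"
proof (rule eq_vecI)
  fix i assume i: "i < dim_vec y"
  show "x $ i = y $ i"
  proof (rule fcoeff_eqI)
    fix j assume "j < CARD('k)"
    then have "cft_vec_block j x $ i = cft_vec_block j y $ i" by (simp add: assms(3))
    then show "fcoeff j (x $ i) = fcoeff j (y $ i)"
      using assms(1,2) i by (simp add: cft_vec_block_def)
  qed
qed (use assms in simp)

lemma cft_mat_block_dim [simp]:
  "cft_mat_block j A \<in> carrier_mat n m \<longleftrightarrow> A \<in> carrier_mat n m"
  by (simp add: cft_mat_block_def)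

lemma cft_vec_block_dim [simp]: "cft_vec_block j x \<in> carrier_vec n \<longleftrightarrow> x \<in> carrier_vec n"
  by (simp add: cft_vec_block_def)

lemma cft_vec_block_mult:
  fixes A :: "'k::finite circulant mat"
  assumes "j < CARD('k)" "A \<in> carrier_mat n m" "x \<in> carrier_vec m"
  shows "cft_vec_block j (A *\<^sub>v x) = cft_mat_block j A *\<^sub>v cft_vec_block j x"
proof -
  interpret comm_ring_hom "fcoeff j :: 'k circulant \<Rightarrow> complex"
    by (rule comm_ring_hom_fcoeff) fact
  show ?thesis
    unfolding cft_vec_block_def cft_mat_block_def by (rule mult_mat_vec_hom) fact+
qed

lemma cft_vec_block_smult:
  "j < CARD('k) \<Longrightarrow>
     cft_vec_block j (a \<cdot>\<^sub>v x) = fcoeff j (a :: 'k::finite circulant) \<cdot>\<^sub>v cft_vec_block j x"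
  by (rule eq_vecI) (auto simp: cft_vec_block_def fcoeff_times)

lemma fcoeff_det:
  fixes A :: "'k::finite circulant mat"
  assumes "j < CARD('k)"
  shows "fcoeff j (det A) = det (cft_mat_block j A)"
proof -
  interpret comm_ring_hom "fcoeff j :: 'k circulant \<Rightarrow> complex"
    by (rule comm_ring_hom_fcoeff) fact
  show ?thesis by (simp add: cft_mat_block_def)
qed

text \<open>Connects the determinant condition on a circulant eigenvalue with
  \<open>char_matrix\<close>, whose singularity characterizes eigenvalues of a complex
  block.\<close>

lemma cft_mat_block_char:
  fixes A :: "'k::finite circulant mat"
  assumes j: "j < CARD('k)" and A: "A \<in> carrier_mat n n"
  shows "cft_mat_block j (A - l \<cdot>\<^sub>m 1\<^sub>m n) = char_matrix (cft_mat_block j A) (fcoeff j l)"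
proof -
  interpret comm_ring_hom "fcoeff j :: 'k circulant \<Rightarrow> complex"
    by (rule comm_ring_hom_fcoeff) fact
  show ?thesis
    using A by (intro eq_matI)
      (auto simp: cft_mat_block_def char_matrix_def hom_distribs)
qed

text \<open>The equations hold over the circulants exactly when they hold in all blocks. From right
  to left, the determinant vanishes because \<open>fcoeff j l\<close> is an eigenvalue of every
  block.\<close>

lemma circ_eigenpair_iff:
  fixes A :: "'k::finite circulant mat"
  assumes A: "A \<in> carrier_mat n n"
  shows "circ_eigenpair A l x \<longleftrightarrow> x \<in> carrier_vec n \<and>
    (\<forall>j<CARD('k). eigenvector (cft_mat_block j A) (cft_vec_block j x) (fcoeff j l))"
    (is "?L \<longleftrightarrow> ?R")
proof
  assume ?L
  then have x: "x \<in> carrier_vec n" and Ax: "A *\<^sub>v x = l \<cdot>\<^sub>v x"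
    and nz: "\<And>j. j < CARD('k) \<Longrightarrow> cft_vec_block j x \<noteq> 0\<^sub>v n"
    using A by (auto simp: circ_eigenpair_def)
  have "cft_mat_block j A *\<^sub>v cft_vec_block j x = fcoeff j l \<cdot>\<^sub>v cft_vec_block j x"
    if "j < CARD('k)" for j
    using cft_vec_block_mult[OF that A x] cft_vec_block_smult[OF that, of l x] Ax by simp
  moreover have "dim_row (cft_mat_block j A) = n" for j
    using A by (simp add: cft_mat_block_def)
  ultimately show ?R using x nz by (simp add: eigenvector_def)
next
  assume R: ?R
  have dim: "dim_row (cft_mat_block j A) = n" for j
    using A by (simp add: cft_mat_block_def)
  have x: "x \<in> carrier_vec n" using R by blast
  have ev: "cft_vec_block j x \<noteq> 0\<^sub>v n"
    "cft_mat_block j A *\<^sub>v cft_vec_block j x = fcoeff j l \<cdot>\<^sub>v cft_vec_block j x"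
    "eigenvalue (cft_mat_block j A) (fcoeff j l)"
    if "j < CARD('k)" for j
    using R that dim by (force simp: eigenvector_def, force simp: eigenvector_def, auto simp: eigenvalue_def)
  have "A *\<^sub>v x = l \<cdot>\<^sub>v x"
    by (rule circulant_vec_eqI[of _ n])
      (use A x ev(2) in \<open>simp_all add: cft_vec_block_mult[OF _ A x] cft_vec_block_smult\<close>)
  moreover have "det (A - l \<cdot>\<^sub>m 1\<^sub>m n) = 0"
  proof (rule fcoeff_eqI)
    fix j assume j: "j < CARD('k)"
    show "fcoeff j (det (A - l \<cdot>\<^sub>m 1\<^sub>m n)) = fcoeff j (0 :: 'k circulant)"
      using ev(3)[OF j] A eigenvalue_det[of "cft_mat_block j A" n]
      by (simp add: fcoeff_det[OF j] cft_mat_block_char[OF j A] fcoeff_zero[OF j])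
  qed
  ultimately show ?L using A x ev(1) by (simp add: circ_eigenpair_def)
qed

subsection \<open>Enumerating a finite set by decreasing modulus\<close>

lemma decreasing_enumeration_exists:
  fixes S :: "complex set"
  assumes "finite S" "card S = n"
  shows "\<exists>f. f ` {..<n} = S \<and> (\<forall>i i'. i < i' \<longrightarrow> i' < n \<longrightarrow> cmod (f i') \<le> cmod (f i))"
proof -
  obtain xs where xs: "set xs = S" "distinct xs" using finite_distinct_list[OF assms(1)] by blast
  \<comment> \<open>\<open>sort_key\<close> sorts increasingly, so the negated modulus puts the
    largest modulus first.\<close>
  define ys where "ys = sort_key (\<lambda>z. - cmod z) xs"
  have ys: "set ys = S" "length ys = n"
    using xs assms(2) distinct_card[OF xs(2)] by (auto simp: ys_def)
  have "sorted (map (\<lambda>z. - cmod z) ys)" by (simp add: ys_def)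
  then have "cmod (ys ! i') \<le> cmod (ys ! i)" if "i < i'" "i' < n" for i i'
    using sorted_nth_mono[of "map (\<lambda>z. - cmod z) ys" i i'] that ys(2) by simp
  moreover have "(!) ys ` {..<n} = S" using ys by (auto simp: set_conv_nth)
  ultimately show ?thesis by blast
qed

text \<open>Mapping \<open>n\<close> indices onto \<open>n\<close> elements, \<open>f\<close> and
  \<open>g\<close> are injective, so their moduli decrease strictly. Two strictly sorted lists with
  the same elements coincide, and on \<open>S\<close> the modulus determines the element.\<close>

lemma decreasing_enumeration_unique:
  fixes f g :: "nat \<Rightarrow> complex"
  assumes inj: "inj_on cmod S" and card: "card S = n"
    and f: "f ` {..<n} = S" "\<And>i i'. i < i' \<Longrightarrow> i' < n \<Longrightarrow> cmod (f i') \<le> cmod (f i)"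
    and g: "g ` {..<n} = S" "\<And>i i'. i < i' \<Longrightarrow> i' < n \<Longrightarrow> cmod (g i') \<le> cmod (g i)"
    and i: "i < n"
  shows "f i = g i"
proof -
  let ?L = "\<lambda>h. map (\<lambda>i. - cmod (h i)) [0..<n]"
  have strict: "sorted_wrt (<) (?L h)"
    if h: "h ` {..<n} = S" "\<And>i i'. i < i' \<Longrightarrow> i' < n \<Longrightarrow> cmod (h i') \<le> cmod (h i)"
    for h :: "nat \<Rightarrow> complex"
  proof -
    have "inj_on h {..<n}" by (rule eq_card_imp_inj_on) (simp_all add: h(1) card)
    then have "cmod (h i) \<noteq> cmod (h i')" if "i < i'" "i' < n" for i i'
      using inj h(1) that by (auto simp: inj_on_def) (metis image_eqI lessThan_iff less_trans nat_neq_iff)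
    then have "cmod (h i') < cmod (h i)" if "i < i'" "i' < n" for i i'
      using h(2)[OF that] that by (metis order_le_less)
    then show ?thesis by (simp add: sorted_wrt_iff_nth_less)
  qed
  have "set (?L h) = (\<lambda>z. - cmod z) ` h ` {..<n}" for h
    by (simp add: image_image atLeast0LessThan)
  then have "set (?L f) = set (?L g)" by (simp only: f(1) g(1))
  moreover have "sorted_wrt (<) (?L f)" by (rule strict) (fact f)+
  moreover have "sorted_wrt (<) (?L g)" by (rule strict) (fact g)+
  ultimately have "?L f = ?L g" by (intro strict_sorted_equal)
  then have "cmod (f i) = cmod (g i)" using i by simp
  moreover have "f i \<in> S" "g i \<in> S" using f(1) g(1) i by auto
  ultimately show ?thesis using inj by (auto dest: inj_onD)
qed

subsection \<open>Canonical sets\<close>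

text \<open>A complex \<open>n\<close> by \<open>n\<close> block has at most \<open>n\<close>
  eigenvalues, so \<open>card_spectrum\<close> says that all of them are simple.\<close>

locale distinct_magnitude_blocks =
  fixes A :: "'k::finite circulant mat" and n :: nat
  assumes A: "A \<in> carrier_mat n n"
    and card_spectrum: "\<And>j. j < CARD('k) \<Longrightarrow> card (spectrum (cft_mat_block j A)) = n"
    and inj_cmod: "\<And>j. j < CARD('k) \<Longrightarrow> inj_on cmod (spectrum (cft_mat_block j A))"
begin

section \<open>Size and existence of canonical sets\<close>

lemma block_dim: "cft_mat_block j A \<in> carrier_mat n n"
  using A by simp

lemma reproducing_covers:
  assumes ps: "reproducing A ps" and j: "j < CARD('k)"
  shows "(\<lambda>p. fcoeff j (fst p)) ` set ps = spectrum (cft_mat_block j A)"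
proof
  show "(\<lambda>p. fcoeff j (fst p)) ` set ps \<subseteq> spectrum (cft_mat_block j A)"
    using ps j by (fastforce simp: reproducing_def circ_eigenpair_iff[OF A] spectrum_def eigenvalue_def)
  show "spectrum (cft_mat_block j A) \<subseteq> (\<lambda>p. fcoeff j (fst p)) ` set ps"
  proof
    fix m assume "m \<in> spectrum (cft_mat_block j A)"
    then obtain v where "eigenvector (cft_mat_block j A) v m"
      by (auto simp: spectrum_def eigenvalue_def)
    then show "m \<in> (\<lambda>p. fcoeff j (fst p)) ` set ps"
      using ps j unfolding reproducing_def by force
  qed
qed

text \<open>Block \<open>0\<close> alone has \<open>n\<close> eigenvalues, and each pair accounts
  for only one of them.\<close>

lemma reproducing_length:
  assumes "reproducing A ps" shows "n \<le> length ps"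
proof -
  have "n = card ((\<lambda>p. fcoeff 0 (fst p)) ` set ps)"
    using reproducing_covers[OF assms CARD_pos] card_spectrum[OF CARD_pos] by simp
  also have "\<dots> \<le> card (set ps)" by (rule card_image_le) simp
  also have "\<dots> \<le> length ps" by (rule card_length)
  finally show ?thesis .
qed

text \<open>The \<open>i\<close>-th pair is glued from the \<open>i\<close>-th eigenvalue, by
  decreasing modulus, of every block and an eigenvector for it. The \<open>n\<close> pairs attain
  the lower bound of \<open>reproducing_length\<close>.\<close>

lemma canonical_set_exists: "\<exists>ps. canonical_set A ps \<and> length ps = n"
proof -
  let ?S = "\<lambda>j. spectrum (cft_mat_block j A)"
  \<comment> \<open>The bound on \<open>j\<close> stands inside the existential so that a choice
    function on all of \<open>nat\<close> can be extracted.\<close>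
  have "\<forall>j. \<exists>f. j < CARD('k) \<longrightarrow> f ` {..<n} = ?S j \<and>
      (\<forall>i i'. i < i' \<longrightarrow> i' < n \<longrightarrow> cmod (f i') \<le> cmod (f i))"
    using decreasing_enumeration_exists[OF card_finite_spectrum(1)[OF block_dim] card_spectrum]
    by metis
  then obtain \<mu> where "\<forall>j. j < CARD('k) \<longrightarrow> \<mu> j ` {..<n} = ?S j \<and>
      (\<forall>i i'. i < i' \<longrightarrow> i' < n \<longrightarrow> cmod (\<mu> j i') \<le> cmod (\<mu> j i))"
    by metis
  then have \<mu>: "\<mu> j ` {..<n} = ?S j"
      "\<And>i i'. i < i' \<Longrightarrow> i' < n \<Longrightarrow> cmod (\<mu> j i') \<le> cmod (\<mu> j i)"
    if "j < CARD('k)" for j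
    using that by blast+
  have "\<forall>j i. \<exists>v. j < CARD('k) \<longrightarrow> i < n \<longrightarrow> eigenvector (cft_mat_block j A) v (\<mu> j i)"
  proof (intro allI)
    fix j i
    show "\<exists>v. j < CARD('k) \<longrightarrow> i < n \<longrightarrow> eigenvector (cft_mat_block j A) v (\<mu> j i)"
    proof (cases "j < CARD('k) \<and> i < n")
      case True
      then have "\<mu> j i \<in> spectrum (cft_mat_block j A)" using \<mu>(1) by blast
      then show ?thesis by (auto simp: spectrum_def eigenvalue_def)
    qed blast
  qed
  then obtain v where v: "eigenvector (cft_mat_block j A) (v j i) (\<mu> j i)"
    if "j < CARD('k)" "i < n" for j i
    by metis
  define l :: "nat \<Rightarrow> 'k circulant" where "l i = of_fcoeffs (\<lambda>j. \<mu> j i)" for i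
  define x :: "nat \<Rightarrow> 'k circulant Matrix.vec"
    where "x i = Matrix.vec n (\<lambda>r. of_fcoeffs (\<lambda>j. v j i $ r))" for i
  have l: "fcoeff j (l i) = \<mu> j i" if "j < CARD('k)" for i j
    using that by (simp add: l_def fcoeff_of_fcoeffs)
  have x: "cft_vec_block j (x i) = v j i" if "j < CARD('k)" "i < n" for i j
    using that eigenvector_carrier[OF v[OF that] block_dim]
    by (intro eq_vecI) (auto simp: cft_vec_block_def x_def fcoeff_of_fcoeffs)
  define ps where "ps = map (\<lambda>i. (l i, x i)) [0..<n]"
  have "circ_eigenpair A (l i) (x i)" if "i < n" for i
    using that v l x by (auto simp: circ_eigenpair_iff[OF A] x_def)
  \<comment> \<open>Any eigenvalue \<open>m\<close> of block \<open>j\<close> occurs in the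
    enumeration, and its eigenspace is one-dimensional, so the chosen eigenvector represents
    \<open>u\<close> up to a scalar.\<close>
  moreover have "\<exists>i<n. fcoeff j (l i) = m \<and> (\<exists>c. c \<noteq> 0 \<and> u = c \<cdot>\<^sub>v cft_vec_block j (x i))"
    if j: "j < CARD('k)" and u: "eigenvector (cft_mat_block j A) u m" for j m u
  proof -
    have "m \<in> \<mu> j ` {..<n}" using u \<mu>(1)[OF j] by (auto simp: spectrum_def eigenvalue_def)
    then obtain i where i: "i < n" "m = \<mu> j i" by auto
    have inj: "inj_on (\<mu> j) {..<n}"
      by (rule eq_card_imp_inj_on) (simp_all add: \<mu>(1) card_spectrum j)
    have "\<exists>c. c \<noteq> 0 \<and> u = c \<cdot>\<^sub>v map (v j) [0..<n] ! i"
      by (rule eigenvector_unique_up_to_scaling[OF block_dim _ inj])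
        (use i u v[OF j] in auto)
    then show ?thesis using i x[OF j i(1)] l[OF j] by (intro exI[of _ i]) simp
  qed
  ultimately have rep: "reproducing A ps"
    unfolding reproducing_def ps_def by fastforce
  have "sorted_wrt (\<lambda>(l, _) (l', _). circ_le (circ_abs l') (circ_abs l)) ps"
    by (auto simp: ps_def sorted_wrt_iff_nth_less circ_le_circ_abs_iff l \<mu>(2))
  moreover have len: "length ps = n" by (simp add: ps_def)
  ultimately have "canonical_set A ps"
    using rep reproducing_length by (simp add: canonical_set_def)
  then show ?thesis using len by blast
qed

text \<open>Any two canonical sets are reproducing and of minimal length, so \<open>ps\<close> is as
  long as the one constructed above.\<close>

lemma canonical_set_length: "canonical_set A ps \<Longrightarrow> length ps = n"
  using canonical_set_exists unfolding canonical_set_def by (metis le_antisym)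

section \<open>Uniqueness of the canonical set\<close>

lemma canonical_set_enumerates:
  assumes ps: "canonical_set A ps" and j: "j < CARD('k)"
  shows "(\<lambda>i. fcoeff j (fst (ps ! i))) ` {..<n} = spectrum (cft_mat_block j A)"
    and "i < i' \<Longrightarrow> i' < n \<Longrightarrow> cmod (fcoeff j (fst (ps ! i'))) \<le> cmod (fcoeff j (fst (ps ! i)))"
    and "inj_on (\<lambda>i. fcoeff j (fst (ps ! i))) {..<n}"
    and "i < n \<Longrightarrow>
      eigenvector (cft_mat_block j A) (cft_vec_block j (snd (ps ! i))) (fcoeff j (fst (ps ! i)))"
proof -
  have rep: "reproducing A ps" using ps by (simp add: canonical_set_def)
  have len: "length ps = n" by (rule canonical_set_length[OF ps])
  have "set ps = (!) ps ` {..<n}" using len by (auto simp: set_conv_nth)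
  then show img: "(\<lambda>i. fcoeff j (fst (ps ! i))) ` {..<n} = spectrum (cft_mat_block j A)"
    using reproducing_covers[OF rep j] by (simp add: image_image)
  show "cmod (fcoeff j (fst (ps ! i'))) \<le> cmod (fcoeff j (fst (ps ! i)))" if "i < i'" "i' < n"
  proof -
    have "circ_le (circ_abs (fst (ps ! i'))) (circ_abs (fst (ps ! i)))"
      using ps that len unfolding canonical_set_def
      by (auto simp: sorted_wrt_iff_nth_less case_prod_unfold)
    then show ?thesis using j by (simp add: circ_le_circ_abs_iff)
  qed
  \<comment> \<open>The \<open>n\<close> positions hit all \<open>n\<close> eigenvalues of the
    block, hence none twice.\<close>
  show "inj_on (\<lambda>i. fcoeff j (fst (ps ! i))) {..<n}"
    by (rule eq_card_imp_inj_on) (simp_all add: img card_spectrum[OF j])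
  show "eigenvector (cft_mat_block j A) (cft_vec_block j (snd (ps ! i))) (fcoeff j (fst (ps ! i)))"
    if "i < n"
  proof -
    have "ps ! i \<in> set ps" using that len by simp
    then have "circ_eigenpair A (fst (ps ! i)) (snd (ps ! i))"
      using rep by (auto simp: reproducing_def case_prod_unfold)
    then show ?thesis using j by (simp add: circ_eigenpair_iff[OF A])
  qed
qed

lemma canonical_set_carrier:
  assumes ps: "canonical_set A ps" and i: "i < n"
  shows "snd (ps ! i) \<in> carrier_vec n"
  using eigenvector_carrier[OF canonical_set_enumerates(4)[OF ps CARD_pos i] block_dim] by simp

text \<open>In every block both sets list the spectrum by decreasing modulus, which fixes the
  eigenvalues; the eigenvectors then lie in the same one-dimensional eigenspaces.\<close>

lemma canonical_set_unique:
  assumes ps: "canonical_set A ps" and qs: "canonical_set A qs"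
  shows "list_all2 same_up_to_normalization ps qs"
proof (rule list_all2_all_nthI)
  show "length ps = length qs" using canonical_set_length[OF ps] canonical_set_length[OF qs] by simp
  fix i assume "i < length ps"
  then have i: "i < n" using canonical_set_length[OF ps] by simp
  note psE = canonical_set_enumerates[OF ps] and qsE = canonical_set_enumerates[OF qs]
  have val: "fcoeff j (fst (ps ! i)) = fcoeff j (fst (qs ! i))" if j: "j < CARD('k)" for j
    by (rule decreasing_enumeration_unique[OF inj_cmod[OF j] card_spectrum[OF j]
          psE(1)[OF j] psE(2)[OF j] qsE(1)[OF j] qsE(2)[OF j] i])
  have "\<exists>c. c \<noteq> 0 \<and> cft_vec_block j (snd (ps ! i)) = c \<cdot>\<^sub>v cft_vec_block j (snd (qs ! i))"
    if j: "j < CARD('k)" for j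
  proof -
    let ?vs = "map (\<lambda>i. cft_vec_block j (snd (qs ! i))) [0..<n]"
    have "\<exists>c. c \<noteq> 0 \<and> cft_vec_block j (snd (ps ! i)) = c \<cdot>\<^sub>v ?vs ! i"
      by (rule eigenvector_unique_up_to_scaling[OF block_dim _ qsE(3)[OF j]])
        (use i psE(4)[OF j i] qsE(4)[OF j] val[OF j] in auto)
    then show ?thesis using i by simp
  qed
  then obtain c where c: "c j \<noteq> 0"
      "cft_vec_block j (snd (ps ! i)) = c j \<cdot>\<^sub>v cft_vec_block j (snd (qs ! i))"
    if "j < CARD('k)" for j
    by metis
  \<comment> \<open>The scalars of the blocks are glued into one circulant, which is a unit because
    none of them is zero.\<close>
  let ?u = "of_fcoeffs c :: 'k circulant"
  have "?u dvd 1" using c(1) by (simp add: dvd_one_iff_fcoeff fcoeff_of_fcoeffs)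
  moreover have "snd (ps ! i) = ?u \<cdot>\<^sub>v snd (qs ! i)"
    by (rule circulant_vec_eqI[of _ n])
      (use canonical_set_carrier[OF ps i] canonical_set_carrier[OF qs i] c(2)
        in \<open>simp_all add: cft_vec_block_smult fcoeff_of_fcoeffs\<close>)
  moreover have "fst (ps ! i) = fst (qs ! i)" by (rule fcoeff_eqI) (rule val)
  ultimately show "same_up_to_normalization (ps ! i) (qs ! i)"
    unfolding same_up_to_normalization_def by blast
qed

section \<open>Invertibility of the eigenvector matrix and the eigendecomposition\<close>

lemma canonical_set_det:
  assumes ps: "canonical_set A ps"
  shows "det (mat_of_cols n (map snd ps)) dvd 1"
  unfolding dvd_one_iff_fcoeff
proof (intro allI impI)
  fix j assume j: "j < CARD('k)"
  have len: "length ps = n" by (rule canonical_set_length[OF ps])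
  let ?vs = "map (\<lambda>p. cft_vec_block j (snd p)) ps"
  \<comment> \<open>The columns of block \<open>j\<close> of the eigenvector matrix are eigenvectors
    of block \<open>j\<close> of \<open>A\<close> for distinct eigenvalues, so
    \<open>det_eigenvectors_nonzero\<close> applies.\<close>
  have "cft_mat_block j (mat_of_cols n (map snd ps)) = mat_of_cols n ?vs"
    using canonical_set_carrier[OF ps, unfolded carrier_vec_def] len
    by (intro eq_matI) (auto simp: cft_mat_block_def cft_vec_block_def mat_of_cols_index)
  moreover have "det (mat_of_cols n ?vs) \<noteq> 0"
    by (rule det_eigenvectors_nonzero[OF block_dim _ canonical_set_enumerates(3)[OF ps j]])
      (use canonical_set_enumerates(4)[OF ps j] len in auto)
  ultimately show "fcoeff j (det (mat_of_cols n (map snd ps))) \<noteq> 0"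
    by (simp add: fcoeff_det[OF j])
qed

text \<open>Column by column this is the eigenvector equation, since a diagonal matrix on the right
  scales the columns.\<close>

lemma canonical_set_mult:
  assumes ps: "canonical_set A ps"
  shows "A * mat_of_cols n (map snd ps) =
    mat_of_cols n (map snd ps) * mat_diag n (\<lambda>i. fst (ps ! i))"
    (is "A * ?X = ?X * _")
proof -
  have len: "length ps = n" by (rule canonical_set_length[OF ps])
  have X: "?X \<in> carrier_mat n n" using len by auto
  have "(A * ?X) $$ (r, i) = ?X $$ (r, i) * fst (ps ! i)" if r: "r < n" and i: "i < n" for r i
  proof -
    have "circ_eigenpair A (fst (ps ! i)) (snd (ps ! i))"
      using ps i len by (auto simp: canonical_set_def reproducing_def case_prod_unfold)
    then have ev: "A *\<^sub>v snd (ps ! i) = fst (ps ! i) \<cdot>\<^sub>v snd (ps ! i)"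
      by (simp add: circ_eigenpair_def)
    have "(A * ?X) $$ (r, i) = col (A * ?X) i $ r" by (rule index_col[symmetric]) (use A X r i in auto)
    also have "\<dots> = (A *\<^sub>v snd (ps ! i)) $ r"
      using canonical_set_carrier[OF ps i] i len by (simp add: col_mult2[OF A X i] col_mat_of_cols)
    finally show ?thesis
      using r i len canonical_set_carrier[OF ps i] by (simp add: ev mat_of_cols_index mult.commute)
  qed
  then show ?thesis
    unfolding mat_diag_mult_right[OF X] using A X by (intro eq_matI) auto
qed

end

theorem theorem7:
  fixes A :: "'k::finite circulant mat" and n :: nat
  assumes A: "A \<in> carrier_mat n n"
    and distinct_eigenvalues:
      "\<And>j. j < CARD('k) \<Longrightarrow> card (spectrum (cft_mat_block j A)) = n"
    and distinct_magnitudes: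
      "\<And>j. j < CARD('k) \<Longrightarrow> inj_on cmod (spectrum (cft_mat_block j A))"
  shows "(\<exists>ps. canonical_set A ps) \<and>
    (\<forall>ps qs. canonical_set A ps \<longrightarrow> canonical_set A qs \<longrightarrow>
       list_all2 same_up_to_normalization ps qs) \<and>
    (\<forall>ps. canonical_set A ps \<longrightarrow>
       length ps = n \<and>
       free_basis n (map snd ps) \<and>
       (let X = mat_of_cols n (map snd ps); \<Lambda> = mat_diag n (\<lambda>i. fst (ps ! i))
        in \<exists>Y \<in> carrier_mat n n. inverts_mat X Y \<and> inverts_mat Y X \<and> A = X * \<Lambda> * Y))"
proof -
  interpret distinct_magnitude_blocks A n by unfold_locales fact+
  have "free_basis n (map snd ps) \<and>
      (\<exists>Y \<in> carrier_mat n n. inverts_mat (mat_of_cols n (map snd ps)) Y \<and>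
         inverts_mat Y (mat_of_cols n (map snd ps)) \<and>
         A = mat_of_cols n (map snd ps) * mat_diag n (\<lambda>i. fst (ps ! i)) * Y)"
    if ps: "canonical_set A ps" for ps
  proof -
    let ?X = "mat_of_cols n (map snd ps)"
    have len: "length ps = n" by (rule canonical_set_length[OF ps])
    have X: "?X \<in> carrier_mat n n" using len by auto
    obtain Y where Y: "Y \<in> carrier_mat n n" "?X * Y = 1\<^sub>m n" "Y * ?X = 1\<^sub>m n"
      by (rule inverse_of_unit_det[OF X canonical_set_det[OF ps]])
    have "free_basis n (map snd ps)"
      by (rule free_basis_of_invertible[OF _ _ Y])
        (use len canonical_set_carrier[OF ps] in \<open>auto simp: set_conv_nth\<close>)
    moreover have "A = ?X * mat_diag n (\<lambda>i. fst (ps ! i)) * Y"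
    proof -
      \<comment> \<open>Multiplying \<open>canonical_set_mult\<close> by \<open>Y\<close> on the
        right turns \<open>A * ?X\<close> into \<open>A\<close>.\<close>
      have "?X * mat_diag n (\<lambda>i. fst (ps ! i)) * Y = A * (?X * Y)"
        unfolding canonical_set_mult[OF ps, symmetric] by (rule assoc_mult_mat[OF A X Y(1)])
      then show ?thesis using A Y(2) by simp
    qed
    moreover have "inverts_mat ?X Y" "inverts_mat Y ?X"
      using X Y by (simp_all add: inverts_mat_def)
    ultimately show ?thesis using Y(1) by blast
  qed
  then show ?thesis
    unfolding Let_def
    using canonical_set_exists canonical_set_unique canonical_set_length by blast
qed

end
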